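(* Let $p\in[1,\infty)$, and let $(\rho_k)_{k\in\mathbb N}$, $(w_k)_{k\in\mathbb N}$ and $w$ be as in the standing assumptions of the context. Assume that $(\rho_k)_{k\in\mathbb N}$ is $p$-compact, that $w>0$ on $\mathbb R^{2N}$, and let $R>0$. If $(u_k)_{k\in\mathbb N}\subset L^p_R(\mathbb R^N)$ is such that $$\sup_{k\in\mathbb N}\big(\|u_k\|_{L^p}+\mathscr F^{w_k}_{k,p}(u_k)\big)<\infty,$$ then $(u_k)_{k\in\mathbb N}$ is compact in $L^p(\mathbb R^N)$.
   Context: Standing assumptions. $p\in[1,\infty)$. Kernels: $(\rho_k)_{k\in\mathbb N}\subset L^1_{\rm loc}(\mathbb R^N)$, $\rho_k\ge0$, with $$\sup_{R>0}\limsup_{k\to\infty}R^p\int_{\mathbb R^N}\frac{\rho_k(z)}{R^p+|z|^p}\,dz<\infty,$$ and, for some $\alpha\ge0$, the measures $\rho_k\mathscr L^N$ converge weakly-* to $\alpha\delta_0$ in $\mathscr M_{\rm loc}(\mathbb R^N)$ (tested against $C_c(\mathbb R^N)$). Weights: $(w_k)_{k\in\mathbb N}\subset L^\infty(\mathbb R^{2N})$, $w_k\ge0$, $w_k\to w$ in $L^\infty(\mathbb R^{2N})$, where $w\in C_b(\mathbb R^{2N})$, $w\ge0$, and $|w(x,y)-w(x',y')|\le\omega(|x-x'|+|y-y'|)$ for all $x,x',y,y'\in\mathbb R^N$, with $\omega\colon[0,\infty)\to[0,\infty)$ non-decreasing and $\lim_{t\to0^+}\omega(t)=\omega(0)=0$.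 Functionals: for a non-negative weight $v\in L^\infty(\mathbb R^{2N})$ and $u\in L^p(\mathbb R^N)$, $$\mathscr F^{v}_{k,p}(u)=\int_{\mathbb R^N}\int_{\mathbb R^N}\frac{|u(x)-u(y)|^p}{|x-y|^p}\,\rho_k(x-y)\,v(x,y)\,dx\,dy\in[0,\infty];$$ $\mathscr F^1_{k,p}$ is the case $v\equiv1$. $L^p_R(\mathbb R^N)=\{u\in L^p(\mathbb R^N):\operatorname{supp}u\subset\overline{B}_R\}$. A sequence $(u_k)_{k\in\mathbb N}\subset L^p(\mathbb R^N)$ is $p$-energy bounded if $\sup_{k\in\mathbb N}\big(\|u_k\|_{L^p}+\mathscr F^1_{k,p}(u_k)\big)<\infty$. The family $(\rho_k)_{k\in\mathbb N}$ is $p$-compact if any $p$-energy bounded sequence in $L^p(\mathbb R^N)$ is compact in $L^p(E)$ for every compact set $E\subset\mathbb R^N$. Here a sequence is called compact in a Banach space if it is relatively compact, i.e. every subsequence has a convergent further subsequence. *)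

theory Defs
  imports "HOL-Probability.Essential_Supremum"
begin

text \<open>
  The space \<open>\<real>\<^sup>N\<close>, with \<open>N \<ge> 1\<close> arbitrary, is a type \<open>'a :: euclidean_space\<close>, and
  \<open>\<real>\<^sup>2\<^sup>N\<close> is \<open>'a \<times> 'a\<close>.  Elements of Lebesgue spaces are represented by
  Lebesgue measurable real functions; sign conditions on them are meant almost everywhere.
\<close>

definition Lp_space :: "'b measure \<Rightarrow> real \<Rightarrow> ('b \<Rightarrow> real) set" where
  "Lp_space M p = {u \<in> borel_measurable M. integrable M (\<lambda>x. \<bar>u x\<bar> powr p)}"

definition Lp_norm :: "'b measure \<Rightarrow> real \<Rightarrow> ('b \<Rightarrow> real) \<Rightarrow> real" where
  "Lp_norm M p u = (LINT x|M. \<bar>u x\<bar> powr p) powr (1 / p)"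

definition Linf_norm :: "'b measure \<Rightarrow> ('b \<Rightarrow> real) \<Rightarrow> ennreal" where
  "Linf_norm M f = esssup M (\<lambda>x. ennreal \<bar>f x\<bar>)"

definition Linf_space :: "'b measure \<Rightarrow> ('b \<Rightarrow> real) set" where
  "Linf_space M = {f \<in> borel_measurable M. Linf_norm M f < \<infinity>}"

definition Lp_seq_compact :: "'b measure \<Rightarrow> real \<Rightarrow> (nat \<Rightarrow> 'b \<Rightarrow> real) \<Rightarrow> bool" where
  "Lp_seq_compact M p u \<longleftrightarrow>
     (\<forall>k. u k \<in> Lp_space M p) \<and>
     (\<forall>r::nat \<Rightarrow> nat. strict_mono r \<longrightarrow>
        (\<exists>(s::nat \<Rightarrow> nat) v. strict_mono s \<and> v \<in> Lp_space M p \<and>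
           (\<lambda>k. Lp_norm M p (\<lambda>x. u (r (s k)) x - v x)) \<longlonglongrightarrow> 0))"

text \<open>The support of a class of functions modulo null sets: the complement of the largest
  open set on which the function vanishes almost everywhere.\<close>

definition ess_support :: "('a::euclidean_space \<Rightarrow> real) \<Rightarrow> 'a set" where
  "ess_support u = - \<Union>{U. open U \<and> (AE x in lebesgue. x \<in> U \<longrightarrow> u x = 0)}"

definition Lp_supp :: "real \<Rightarrow> real \<Rightarrow> ('a::euclidean_space \<Rightarrow> real) set" where
  "Lp_supp p R = {u \<in> Lp_space lebesgue p. ess_support u \<subseteq> cball 0 R}"

definition Cc :: "('a::euclidean_space \<Rightarrow> real) set" where
  "Cc = {\<phi>. continuous_on UNIV \<phi> \<and> compact (closure {x. \<phi> x \<noteq> 0})}"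

definition L1_loc :: "('a::euclidean_space \<Rightarrow> real) set" where
  "L1_loc = {f. \<forall>K. compact K \<longrightarrow> set_integrable lebesgue K f}"

text \<open>The integral of \<open>\<phi>\<close> against \<open>\<alpha> \<delta>\<^sub>0\<close> is \<open>\<alpha> * \<phi> 0\<close>.\<close>

definition kernel_family :: "real \<Rightarrow> (nat \<Rightarrow> 'a::euclidean_space \<Rightarrow> real) \<Rightarrow> bool" where
  "kernel_family p \<rho> \<longleftrightarrow>
     (\<forall>k. \<rho> k \<in> L1_loc) \<and>
     (\<forall>k. AE z in lebesgue. 0 \<le> \<rho> k z) \<and>
     (SUP R\<in>{0<..}. limsup (\<lambda>k. ennreal (R powr p) *
        (\<integral>\<^sup>+z. ennreal (\<rho> k z / (R powr p + norm z powr p)) \<partial>lebesgue))) < \<infinity> \<and>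
     (\<exists>\<alpha>\<ge>0. \<forall>\<phi>\<in>Cc. (\<lambda>k. LINT z|lebesgue. \<phi> z * \<rho> k z) \<longlonglongrightarrow> \<alpha> * \<phi> 0)"

definition weight_family ::
  "(nat \<Rightarrow> 'a::euclidean_space \<times> 'a \<Rightarrow> real) \<Rightarrow> ('a \<times> 'a \<Rightarrow> real) \<Rightarrow> bool" where
  "weight_family wk w \<longleftrightarrow>
     (\<forall>k. wk k \<in> Linf_space lebesgue) \<and>
     (\<forall>k. AE z in lebesgue. 0 \<le> wk k z) \<and>
     (\<lambda>k. Linf_norm lebesgue (\<lambda>z. wk k z - w z)) \<longlonglongrightarrow> 0 \<and>
     continuous_on UNIV w \<and> bounded (range w) \<and> (\<forall>z. 0 \<le> w z) \<and>
     (\<exists>\<omega>::real \<Rightarrow> real. (\<forall>t\<ge>0. 0 \<le> \<omega> t) \<and> mono_on {0..} \<omega> \<and>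
        (\<omega> \<longlongrightarrow> 0) (at_right 0) \<and> \<omega> 0 = 0 \<and>
        (\<forall>x y x' y'. \<bar>w (x, y) - w (x', y')\<bar> \<le> \<omega> (norm (x - x') + norm (y - y'))))"

text \<open>On the diagonal, a null set, the quotient is \<open>0 / 0 = 0\<close>.\<close>

definition energy ::
  "real \<Rightarrow> ('a::euclidean_space \<Rightarrow> real) \<Rightarrow> ('a \<times> 'a \<Rightarrow> real) \<Rightarrow> ('a \<Rightarrow> real) \<Rightarrow> ennreal" where
  "energy p \<rho> v u =
     (\<integral>\<^sup>+x. (\<integral>\<^sup>+y. ennreal (\<bar>u x - u y\<bar> powr p / norm (x - y) powr p * \<rho> (x - y) * v (x, y))
        \<partial>lebesgue) \<partial>lebesgue)"

definition energy_bounded ::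
  "real \<Rightarrow> (nat \<Rightarrow> 'a::euclidean_space \<Rightarrow> real) \<Rightarrow> (nat \<Rightarrow> 'a \<Rightarrow> real) \<Rightarrow> bool" where
  "energy_bounded p \<rho> u \<longleftrightarrow>
     (\<forall>k. u k \<in> Lp_space lebesgue p) \<and>
     (SUP k. ennreal (Lp_norm lebesgue p (u k)) + energy p (\<rho> k) (\<lambda>_. 1) (u k)) < \<infinity>"

definition p_compact :: "real \<Rightarrow> (nat \<Rightarrow> 'a::euclidean_space \<Rightarrow> real) \<Rightarrow> bool" where
  "p_compact p \<rho> \<longleftrightarrow>
     (\<forall>u. energy_bounded p \<rho> u \<longrightarrow> (\<forall>E. compact E \<longrightarrow> Lp_seq_compact (lebesgue_on E) p u))"

end

theory Submission
  imports Defs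
begin

text \<open>
  For all large \<open>k\<close>, the weighted energy controls the unweighted one up to constants, so that
  \<open>p\<close>-compactness of the kernels applies to the given sequence up to finitely many members.

  Split the domain of the double integral that defines the unweighted energy of \<open>u k\<close>.  On the
  square \<open>B \<times> B\<close>, where \<open>B\<close> is the closed ball of radius \<open>2 * R\<close>, the positive continuous weight
  \<open>w\<close> is bounded away from zero by compactness, and hence so are the \<open>wk k\<close> for all large \<open>k\<close>, by
  uniform convergence (\<open>weights_eventually_bounded_below\<close>).  Off the square, the integrand
  can be nonzero only if one of the two points lies in the support of \<open>u k\<close>, a part of the ball of
  radius \<open>R\<close>, and the other one lies outside \<open>B\<close>.  Then \<open>u k\<close> vanishes at the latter point and the
  two points have distance at least \<open>R\<close>, so that the difference quotient is at most
  \<open>\<bar>u k x\<bar> powr p / norm (x - y) powr p\<close>, with \<open>x\<close> the point in the support.  Integration in \<open>y\<close>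
  bounds this part by the \<open>p\<close>-th power of the norm of \<open>u k\<close> times the tail integral of the kernel,
  which is bounded for large \<open>k\<close> (\<open>kernel_tail_bounded\<close>).  The outcome is
  \<open>energy_le_weighted_energy\<close>.

  The two uniform bounds hold from some index \<open>K\<close> on only, and the unweighted energies of the first
  members of the sequence can be infinite.  Replacing these members by zero gives an energy
  bounded sequence without affecting compactness.  Its compactness on the ball of radius \<open>R\<close>
  carries over to the whole space because all the functions vanish outside that ball
  (\<open>Lp_seq_compact_extend_by_zero\<close>).
\<close>

section \<open>Translations, reflections and representatives\<close>

lemma lborel_distr_reflect:
  fixes x :: "'a::euclidean_space"
  shows "distr lborel borel (\<lambda>y. x - y) = lborel"
  by (subst lborel_affine[of "-1" x]) (auto simp: density_1)

lemma AE_lborel_reflect: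
  fixes x :: "'a::euclidean_space"
  assumes "AE z in lborel. P z"
  shows "AE y in lborel. P (x - y)"
proof -
  have "AE z in distr lborel borel (\<lambda>y. x - y). P z"
    unfolding lborel_distr_reflect by (rule assms)
  then show ?thesis
    by (rule AE_distrD[rotated]) simp
qed

lemma nn_integral_convolution:
  fixes F H :: "'a::euclidean_space \<Rightarrow> ennreal"
  assumes [measurable]: "F \<in> borel_measurable borel" "H \<in> borel_measurable borel"
  shows "(\<integral>\<^sup>+x. (\<integral>\<^sup>+y. F x * H (x - y) \<partial>lborel) \<partial>lborel) = integral\<^sup>N lborel F * integral\<^sup>N lborel H"
    and "(\<integral>\<^sup>+x. (\<integral>\<^sup>+y. F y * H (x - y) \<partial>lborel) \<partial>lborel) = integral\<^sup>N lborel F * integral\<^sup>N lborel H"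
proof -
  have reflect: "(\<integral>\<^sup>+y. H (x - y) \<partial>lborel) = integral\<^sup>N lborel H" for x
    using nn_integral_distr[of "\<lambda>y. x - y" lborel borel H] by (simp add: lborel_distr_reflect)
  have translate: "(\<integral>\<^sup>+x. H (x - y) \<partial>lborel) = integral\<^sup>N lborel H" for y
    using nn_integral_distr[of "(+) (- y)" lborel borel H] by (simp add: lborel_distr_plus)
  show "(\<integral>\<^sup>+x. (\<integral>\<^sup>+y. F x * H (x - y) \<partial>lborel) \<partial>lborel) = integral\<^sup>N lborel F * integral\<^sup>N lborel H"
    by (simp add: nn_integral_cmult nn_integral_multc reflect)
  have "(\<integral>\<^sup>+x. (\<integral>\<^sup>+y. F y * H (x - y) \<partial>lborel) \<partial>lborel)
      = (\<integral>\<^sup>+y. (\<integral>\<^sup>+x. F y * H (x - y) \<partial>lborel) \<partial>lborel)"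
    by (rule lborel_pair.Fubini') measurable
  then show "(\<integral>\<^sup>+x. (\<integral>\<^sup>+y. F y * H (x - y) \<partial>lborel) \<partial>lborel) = integral\<^sup>N lborel F * integral\<^sup>N lborel H"
    by (simp add: nn_integral_cmult nn_integral_multc translate)
qed

lemma AE_lebesgue_pair:
  fixes P :: "'a::euclidean_space \<times> 'b::euclidean_space \<Rightarrow> bool"
  assumes "AE z in lebesgue. P z"
  shows "AE x in lborel. AE y in lborel. P (x, y)"
proof (rule lborel_pair.AE_pair)
  show "AE z in lborel \<Otimes>\<^sub>M lborel. P z"
    unfolding lborel_prod using assms by (simp add: AE_completion_iff)
qed

lemma energy_eq_lborel:
  "energy p \<rho> v u = (\<integral>\<^sup>+x. (\<integral>\<^sup>+y. ennreal (\<bar>u x - u y\<bar> powr p / norm (x - y) powr p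
      * \<rho> (x - y) * v (x, y)) \<partial>lborel) \<partial>lborel)"
  by (simp add: energy_def nn_integral_completion)

text \<open>Tonelli's theorem and the splitting of integrals need measurability with respect to the product
  \<open>\<sigma>\<close>-algebra, which Lebesgue measurable functions of \<open>x - y\<close> need not have.  The estimates are
  therefore proved for Borel functions and transferred by this invariance under changes on null
  sets: reflection and translation preserve null sets, so the kernel may be changed as well.\<close>

lemma energy_cong_AE:
  fixes u u' \<rho> \<rho>' :: "'a::euclidean_space \<Rightarrow> real"
  assumes u: "AE x in lborel. u x = u' x" and \<rho>: "AE z in lborel. \<rho> z = \<rho>' z"
  shows "energy p \<rho> v u = energy p \<rho>' v u'"
  unfolding energy_eq_lborel
proof (rule nn_integral_cong_AE)
  show "AE x in lborel.
      (\<integral>\<^sup>+y. ennreal (\<bar>u x - u y\<bar> powr p / norm (x - y) powr p * \<rho> (x - y) * v (x, y)) \<partial>lborel) =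
      (\<integral>\<^sup>+y. ennreal (\<bar>u' x - u' y\<bar> powr p / norm (x - y) powr p * \<rho>' (x - y) * v (x, y)) \<partial>lborel)"
    using u
  proof eventually_elim
    case (elim x)
    show ?case
      by (rule nn_integral_cong_AE)
        (use u AE_lborel_reflect[OF \<rho>, of x] in eventually_elim, simp add: elim)
  qed
qed

text \<open>Local integrability gives measurability on each ball, and \<open>f\<close> is the pointwise limit of its
  truncations to growing balls.\<close>

lemma L1_loc_measurable:
  fixes f :: "'a::euclidean_space \<Rightarrow> real"
  assumes "f \<in> L1_loc"
  shows "f \<in> borel_measurable lebesgue"
proof (rule borel_measurable_LIMSEQ_real)
  fix n :: nat
  have "set_integrable lebesgue (cball 0 (real n)) f"
    using assms by (simp add: L1_loc_def)
  then show "(\<lambda>x. indicator (cball 0 (real n)) x *\<^sub>R f x) \<in> borel_measurable lebesgue"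
    by (auto simp: set_integrable_def)
next
  fix x
  have "\<forall>\<^sub>F n in sequentially. indicator (cball 0 (real n)) x *\<^sub>R f x = f x"
    using eventually_ge_at_top[of "nat \<lceil>norm x\<rceil>"] by eventually_elim (auto simp: indicator_def)
  then show "(\<lambda>n. indicator (cball 0 (real n)) x *\<^sub>R f x) \<longlonglongrightarrow> f x"
    by (rule tendsto_eventually)
qed

text \<open>The complement of the essential support is a union of possibly uncountably many open sets on
  each of which \<open>u\<close> vanishes almost everywhere; by Lindelof's theorem countably many suffice.\<close>

lemma AE_zero_off_ess_support:
  fixes u :: "'a::euclidean_space \<Rightarrow> real"
  shows "AE x in lebesgue. x \<notin> ess_support u \<longrightarrow> u x = 0"
proof -
  let ?F = "{U. open U \<and> (AE x in lebesgue. x \<in> U \<longrightarrow> u x = 0)}"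
  obtain G where G: "G \<subseteq> ?F" "countable G" "\<Union>G = \<Union>?F"
    using Lindelof[of ?F] by blast
  have "AE x in lebesgue. \<forall>U\<in>G. x \<in> U \<longrightarrow> u x = 0"
    using G by (subst AE_ball_countable) auto
  then show ?thesis
    by eventually_elim (use G(3) in \<open>auto simp: ess_support_def\<close>)
qed

section \<open>Weighted and unweighted energies of functions with bounded support\<close>

text \<open>A pair outside \<open>B \<times> B\<close> at which the left-hand side is nonzero consists of a point of the ball of
  radius \<open>R\<close> and a point outside \<open>B\<close>, at distance at least \<open>R\<close>.  For such pairs
  \<open>norm (x - y) powr p\<close> is at least half of \<open>R powr p + norm (x - y) powr p\<close>, which gives the
  factor 2 in front of the kernel \<open>T\<close> of the tail condition.\<close>

lemma integrand_le_near_plus_tails: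
  fixes u \<rho> :: "'a::euclidean_space \<Rightarrow> real"
  assumes p: "1 \<le> p" and R: "0 < R" and supp: "\<And>x. x \<notin> cball 0 R \<Longrightarrow> u x = 0"
    and pos: "\<And>z. 0 \<le> \<rho> z"
  defines "B \<equiv> cball (0::'a) (2 * R)" and "T \<equiv> \<lambda>z. \<rho> z / (R powr p + norm z powr p)"
  shows "\<bar>u x - u y\<bar> powr p / norm (x - y) powr p * \<rho> (x - y) \<le>
      indicator (B \<times> B) (x, y) * (\<bar>u x - u y\<bar> powr p / norm (x - y) powr p * \<rho> (x - y))
      + 2 * (\<bar>u x\<bar> powr p * T (x - y)) + 2 * (\<bar>u y\<bar> powr p * T (x - y))"
proof -
  have T0: "0 \<le> T (x - y)"
    using pos by (simp add: T_def)
  have far: "1 / norm (x - y) powr p * \<rho> (x - y) \<le> 2 * T (x - y)" if "R \<le> norm (x - y)"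
  proof -
    have "R powr p \<le> norm (x - y) powr p" "0 < R powr p" "0 < norm (x - y) powr p"
      using that R p by (auto intro!: powr_mono2)
    then have "1 / norm (x - y) powr p \<le> 2 / (R powr p + norm (x - y) powr p)"
      using frac_le[of 2 2 "R powr p + norm (x - y) powr p" "2 * norm (x - y) powr p"]
        add_pos_pos[of "R powr p" "norm (x - y) powr p"] by simp
    then show ?thesis
      using mult_right_mono[OF _ pos[of "x - y"]] by (fastforce simp: T_def)
  qed
  consider "x \<in> B" "y \<in> B" | "u x = 0" "u y = 0" | "u x = 0" "R \<le> norm (x - y)"
    | "u y = 0" "R \<le> norm (x - y)"
  proof -
    have "R \<le> norm (x - y)" if "norm a \<le> R" "norm b > 2 * R" "{a, b} = {x, y}" for a b
      using that norm_triangle_ineq2[of b a] by (auto simp: doubleton_eq_iff norm_minus_commute)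
    then have "R \<le> norm (x - y)" if "norm x \<le> R \<and> norm y > 2 * R \<or> norm y \<le> R \<and> norm x > 2 * R"
      using that by (metis insert_commute)
    then show thesis
      using that supp[of x] supp[of y] R by (fastforce simp: B_def)
  qed
  then show ?thesis
  proof cases
    case 1
    then show ?thesis using T0 by simp
  next
    case 2
    then show ?thesis using p by simp
  next
    case 3
    have "\<bar>u y\<bar> powr p * (1 / norm (x - y) powr p * \<rho> (x - y)) \<le> \<bar>u y\<bar> powr p * (2 * T (x - y))"
      by (rule mult_left_mono[OF far]) (use 3 in auto)
    moreover have "0 \<le> indicator (B \<times> B) (x, y) * (\<bar>u x - u y\<bar> powr p / norm (x - y) powr p * \<rho> (x - y))"
      using pos by simp
    ultimately show ?thesis using 3 by simp
  next
    case 4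
    have "\<bar>u x\<bar> powr p * (1 / norm (x - y) powr p * \<rho> (x - y)) \<le> \<bar>u x\<bar> powr p * (2 * T (x - y))"
      by (rule mult_left_mono[OF far]) (use 4 in auto)
    moreover have "0 \<le> indicator (B \<times> B) (x, y) * (\<bar>u x - u y\<bar> powr p / norm (x - y) powr p * \<rho> (x - y))"
      using pos by simp
    ultimately show ?thesis using 4 by simp
  qed
qed

text \<open>Integrating the pointwise bound: the first summand is compared with the weighted integrand, and
  each of the two tails is a convolution, whose integral factorizes and contributes 2 to the
  constant 4.\<close>

lemma energy_le_weighted_energy_borel:
  fixes u \<rho> :: "'a::euclidean_space \<Rightarrow> real"
  assumes p: "1 \<le> p" and R: "0 < R" and c: "0 < c"
    and [measurable]: "u \<in> borel_measurable borel" "\<rho> \<in> borel_measurable borel"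
    and supp: "\<And>x. x \<notin> cball 0 R \<Longrightarrow> u x = 0" and pos: "\<And>z. 0 \<le> \<rho> z"
    and v: "AE z in lebesgue. z \<in> cball 0 (2 * R) \<times> cball 0 (2 * R) \<longrightarrow> c \<le> v z"
  shows "energy p \<rho> (\<lambda>_. 1) u \<le> ennreal (1 / c) * energy p \<rho> v u
    + 4 * ((\<integral>\<^sup>+x. ennreal (\<bar>u x\<bar> powr p) \<partial>lborel)
         * (\<integral>\<^sup>+z. ennreal (\<rho> z / (R powr p + norm z powr p)) \<partial>lborel))"
proof -
  define B where "B = cball (0::'a) (2 * R)"
  define q where "q x y = \<bar>u x - u y\<bar> powr p / norm (x - y) powr p * \<rho> (x - y)" for x y
  define F where "F x = ennreal (\<bar>u x\<bar> powr p)" for x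
  define H where "H z = ennreal (\<rho> z / (R powr p + norm z powr p))" for z
  define S where "S x y = F x * H (x - y)" for x y
  define S' where "S' x y = F y * H (x - y)" for x y
  define near where "near x y = ennreal (indicator (B \<times> B) (x, y) * q x y)" for x y
  have q0: "0 \<le> q x y" for x y
    using pos by (simp add: q_def)
  have [measurable]: "B \<in> sets borel" "(\<lambda>(x, y). q x y) \<in> borel_measurable (borel \<Otimes>\<^sub>M borel)"
    "F \<in> borel_measurable borel" "H \<in> borel_measurable borel"
    unfolding B_def q_def F_def H_def by measurable
  have [measurable]: "(\<lambda>(x, y). near x y) \<in> borel_measurable (borel \<Otimes>\<^sub>M borel)"
    "(\<lambda>(x, y). S x y) \<in> borel_measurable (borel \<Otimes>\<^sub>M borel)"
    "(\<lambda>(x, y). S' x y) \<in> borel_measurable (borel \<Otimes>\<^sub>M borel)"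
    unfolding near_def S_def S'_def by measurable
  have "energy p \<rho> (\<lambda>_. 1) u = (\<integral>\<^sup>+x. (\<integral>\<^sup>+y. ennreal (q x y) \<partial>lborel) \<partial>lborel)"
    by (simp add: energy_eq_lborel q_def)
  also have "\<dots> \<le> (\<integral>\<^sup>+x. (\<integral>\<^sup>+y. near x y + 2 * S x y + 2 * S' x y \<partial>lborel) \<partial>lborel)"
  proof (intro nn_integral_mono)
    fix x y
    have T0: "0 \<le> \<rho> (x - y) / (R powr p + norm (x - y) powr p)"
      using pos by simp
    have "ennreal (q x y) \<le> ennreal (indicator (B \<times> B) (x, y) * q x y
        + 2 * (\<bar>u x\<bar> powr p * (\<rho> (x - y) / (R powr p + norm (x - y) powr p)))
        + 2 * (\<bar>u y\<bar> powr p * (\<rho> (x - y) / (R powr p + norm (x - y) powr p))))"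
      unfolding q_def B_def by (intro ennreal_leI integrand_le_near_plus_tails[OF p R supp pos])
    also have "\<dots> = near x y + 2 * S x y + 2 * S' x y"
      unfolding near_def S_def S'_def F_def H_def using T0 q0[of x y]
      by (simp add: ennreal_mult del: times_divide_eq_right)
    finally show "ennreal (q x y) \<le> near x y + 2 * S x y + 2 * S' x y" .
  qed
  also have "\<dots> = (\<integral>\<^sup>+x. (\<integral>\<^sup>+y. near x y \<partial>lborel) \<partial>lborel)
      + 2 * (integral\<^sup>N lborel F * integral\<^sup>N lborel H) + 2 * (integral\<^sup>N lborel F * integral\<^sup>N lborel H)"
  proof -
    have "(\<integral>\<^sup>+x. (\<integral>\<^sup>+y. S x y \<partial>lborel) \<partial>lborel) = integral\<^sup>N lborel F * integral\<^sup>N lborel H"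
      "(\<integral>\<^sup>+x. (\<integral>\<^sup>+y. S' x y \<partial>lborel) \<partial>lborel) = integral\<^sup>N lborel F * integral\<^sup>N lborel H"
      unfolding S_def S'_def by (rule nn_integral_convolution; measurable)+
    then show ?thesis
      by (simp add: nn_integral_add nn_integral_cmult)
  qed
  also have "(\<integral>\<^sup>+x. (\<integral>\<^sup>+y. near x y \<partial>lborel) \<partial>lborel) \<le> ennreal (1 / c) * energy p \<rho> v u"
  proof -
    \<comment> \<open>The factor \<open>c\<close> is moved inside the integral of the Borel function \<open>near\<close>: scaling an integral
      requires measurability, whereas the comparison with the weighted integrand is mere
      monotonicity, valid for arbitrary integrands.\<close>
    have "ennreal c * (\<integral>\<^sup>+x. (\<integral>\<^sup>+y. near x y \<partial>lborel) \<partial>lborel)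
        = (\<integral>\<^sup>+x. (\<integral>\<^sup>+y. ennreal c * near x y \<partial>lborel) \<partial>lborel)"
      by (simp add: nn_integral_cmult)
    also have "\<dots> \<le> energy p \<rho> v u"
      unfolding energy_eq_lborel
    proof (rule nn_integral_mono_AE)
      show "AE x in lborel. (\<integral>\<^sup>+y. ennreal c * near x y \<partial>lborel) \<le>
          (\<integral>\<^sup>+y. ennreal (\<bar>u x - u y\<bar> powr p / norm (x - y) powr p * \<rho> (x - y) * v (x, y)) \<partial>lborel)"
        using AE_lebesgue_pair[OF v]
      proof eventually_elim
        case (elim x)
        show ?case
        proof (rule nn_integral_mono_AE, use elim in eventually_elim)
          case (elim y)
          have "c * (indicator (B \<times> B) (x, y) * q x y) \<le> q x y * v (x, y)" if "(x, y) \<in> B \<times> B"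
            using that elim q0[of x y] mult_left_mono[of c "v (x, y)" "q x y"]
            by (simp add: B_def mult.commute)
          then show ?case
            using c q0[of x y]
            by (cases "(x, y) \<in> B \<times> B")
              (auto simp: near_def q_def ennreal_mult[symmetric] intro!: ennreal_leI)
        qed
      qed
    qed
    finally have "ennreal (1 / c) * (ennreal c * (\<integral>\<^sup>+x. (\<integral>\<^sup>+y. near x y \<partial>lborel) \<partial>lborel))
        \<le> ennreal (1 / c) * energy p \<rho> v u"
      by (rule mult_left_mono) simp
    then show ?thesis
      using c by (simp add: mult.assoc[symmetric] ennreal_mult[symmetric])
  qed
  finally show ?thesis
    unfolding F_def H_def by (simp add: add.assoc distrib_right[symmetric])
qed

text \<open>A Borel representative can be made to satisfy, at every point, a constraint that \<open>f\<close> satisfies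
  almost everywhere, as soon as there is a measurable retraction \<open>T\<close> onto the constraint.  It is
  used for the two constraints of vanishing outside a ball and of being non-negative.\<close>

lemma ex_borel_representative:
  fixes f :: "'a::euclidean_space \<Rightarrow> real"
  assumes f: "f \<in> borel_measurable lebesgue" and P: "AE x in lebesgue. f x \<in> P x"
    and A: "\<And>g. g \<in> borel_measurable borel \<Longrightarrow> (\<lambda>x. T x (g x)) \<in> borel_measurable borel"
    and T: "\<And>x t. T x t \<in> P x" "\<And>x t. t \<in> P x \<Longrightarrow> T x t = t"
  obtains g where "g \<in> borel_measurable borel" "AE x in lborel. f x = g x" "\<And>x. g x \<in> P x"
proof -
  obtain g where g: "g \<in> borel_measurable lborel" "AE x in lborel. f x = g x"
    using completion_ex_borel_measurable_real[OF f] by blast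
  have "AE x in lborel. f x = T x (g x)"
    using g(2) P unfolding AE_completion_iff by eventually_elim (auto simp: T)
  then show thesis
    using that[of "\<lambda>x. T x (g x)"] g(1) A T by simp
qed

lemma energy_le_weighted_energy:
  fixes u \<rho> :: "'a::euclidean_space \<Rightarrow> real"
  assumes p: "1 \<le> p" and R: "0 < R" and c: "0 < c"
    and u: "u \<in> borel_measurable lebesgue" and \<rho>: "\<rho> \<in> borel_measurable lebesgue"
    and supp: "AE x in lebesgue. x \<notin> cball 0 R \<longrightarrow> u x = 0"
    and pos: "AE z in lebesgue. 0 \<le> \<rho> z"
    and v: "AE z in lebesgue. z \<in> cball 0 (2 * R) \<times> cball 0 (2 * R) \<longrightarrow> c \<le> v z"
  shows "energy p \<rho> (\<lambda>_. 1) u \<le> ennreal (1 / c) * energy p \<rho> v u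
    + 4 * ((\<integral>\<^sup>+x. ennreal (\<bar>u x\<bar> powr p) \<partial>lebesgue)
         * (\<integral>\<^sup>+z. ennreal (\<rho> z / (R powr p + norm z powr p)) \<partial>lebesgue))"
proof -
  obtain u' where u': "u' \<in> borel_measurable borel" "AE x in lborel. u x = u' x"
      "\<And>x. u' x \<in> (if x \<in> cball 0 R then UNIV else {0})"
    by (rule ex_borel_representative[OF u, of "\<lambda>x. if x \<in> cball 0 R then UNIV else {0}"
          "\<lambda>x t. indicator (cball 0 R) x * t"])
      (use supp in \<open>auto simp: indicator_def elim!: eventually_mono\<close>)
  obtain \<rho>' where \<rho>': "\<rho>' \<in> borel_measurable borel" "AE z in lborel. \<rho> z = \<rho>' z"
      "\<And>z. \<rho>' z \<in> {0..}"
    by (rule ex_borel_representative[OF \<rho>, of "\<lambda>_. {0..}" "\<lambda>_. max 0"])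
      (use pos in \<open>auto simp: max_def elim!: eventually_mono\<close>)
  have "energy p \<rho>' (\<lambda>_. 1) u' \<le> ennreal (1 / c) * energy p \<rho>' v u'
    + 4 * ((\<integral>\<^sup>+x. ennreal (\<bar>u' x\<bar> powr p) \<partial>lborel)
         * (\<integral>\<^sup>+z. ennreal (\<rho>' z / (R powr p + norm z powr p)) \<partial>lborel))"
    by (rule energy_le_weighted_energy_borel[OF p R c u'(1) \<rho>'(1) _ _ v])
      (use u'(3) \<rho>'(3) in \<open>fastforce split: if_splits\<close>)+
  moreover have "(\<integral>\<^sup>+x. ennreal (\<bar>u x\<bar> powr p) \<partial>lebesgue) = (\<integral>\<^sup>+x. ennreal (\<bar>u' x\<bar> powr p) \<partial>lborel)"
    unfolding nn_integral_completion
    by (rule nn_integral_cong_AE) (use u'(2) in eventually_elim, simp)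
  moreover have "(\<integral>\<^sup>+z. ennreal (\<rho> z / (R powr p + norm z powr p)) \<partial>lebesgue)
      = (\<integral>\<^sup>+z. ennreal (\<rho>' z / (R powr p + norm z powr p)) \<partial>lborel)"
    unfolding nn_integral_completion
    by (rule nn_integral_cong_AE) (use \<rho>'(2) in eventually_elim, simp)
  ultimately show ?thesis
    by (simp add: energy_cong_AE[OF u'(2) \<rho>'(2)])
qed

section \<open>Uniform bounds along the families\<close>

lemma nn_integral_powr_eq_Lp_norm:
  assumes "1 \<le> p" and "u \<in> Lp_space M p"
  shows "(\<integral>\<^sup>+x. ennreal (\<bar>u x\<bar> powr p) \<partial>M) = ennreal (Lp_norm M p u powr p)"
proof -
  have "0 \<le> (LINT x|M. \<bar>u x\<bar> powr p)"
    by (rule integral_nonneg_AE) simp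
  then have "Lp_norm M p u powr p = (LINT x|M. \<bar>u x\<bar> powr p)"
    using assms(1) by (simp add: Lp_norm_def powr_powr)
  moreover have "integrable M (\<lambda>x. \<bar>u x\<bar> powr p)"
    using assms(2) by (simp add: Lp_space_def)
  ultimately show ?thesis
    using nn_integral_eq_integral[of M "\<lambda>x. \<bar>u x\<bar> powr p"] by simp
qed

text \<open>A limit superior below a finite number \<open>m\<close> bounds all but finitely many terms by \<open>m\<close>; dividing by
  \<open>R powr p\<close> is harmless as \<open>R\<close> is fixed.\<close>

lemma kernel_tail_bounded:
  fixes \<rho> :: "nat \<Rightarrow> 'a::euclidean_space \<Rightarrow> real"
  assumes "kernel_family p \<rho>" and R: "0 < R"
  obtains M where "0 \<le> M"
    "\<forall>\<^sub>F k in sequentially.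
      (\<integral>\<^sup>+z. ennreal (\<rho> k z / (R powr p + norm z powr p)) \<partial>lebesgue) \<le> ennreal M"
proof -
  define L where "L = (\<lambda>R. limsup (\<lambda>k. ennreal (R powr p) *
        (\<integral>\<^sup>+z. ennreal (\<rho> k z / (R powr p + norm z powr p)) \<partial>lebesgue)))"
  have "(SUP R\<in>{0<..}. L R) < \<infinity>"
    using assms by (simp add: kernel_family_def L_def)
  moreover have "L R \<le> (SUP R\<in>{0<..}. L R)"
    using R by (intro SUP_upper) simp
  ultimately have "L R < \<infinity>"
    by (rule le_less_trans[rotated])
  then obtain M where M: "L R < M" "M < \<infinity>"
    using dense by blast
  obtain m where m: "M = ennreal m" "0 \<le> m"
    using M(2) by (cases M) auto
  have "\<forall>\<^sub>F k in sequentially. ennreal (R powr p) *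
      (\<integral>\<^sup>+z. ennreal (\<rho> k z / (R powr p + norm z powr p)) \<partial>lebesgue) < M"
    by (rule Limsup_lessD) (use M(1) in \<open>simp add: L_def\<close>)
  then have "\<forall>\<^sub>F k in sequentially.
      (\<integral>\<^sup>+z. ennreal (\<rho> k z / (R powr p + norm z powr p)) \<partial>lebesgue) \<le> ennreal (m / R powr p)"
  proof eventually_elim
    case (elim k)
    have "ennreal (1 / R powr p) * (ennreal (R powr p) *
      (\<integral>\<^sup>+z. ennreal (\<rho> k z / (R powr p + norm z powr p)) \<partial>lebesgue)) \<le> ennreal (1 / R powr p) * M"
      by (rule mult_left_mono) (use elim in auto)
    then show ?case
      using R m by (simp add: mult.assoc[symmetric] ennreal_mult[symmetric])
  qed
  then show thesis
    using that[of "m / R powr p"] m R by simp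
qed

text \<open>The constant is half of the minimum of \<open>w\<close> on \<open>K\<close>; once the uniform distance of \<open>wk k\<close> to \<open>w\<close> is
  below it, the other half remains.\<close>

lemma weights_eventually_bounded_below:
  fixes w :: "'a::euclidean_space \<times> 'a \<Rightarrow> real"
  assumes wf: "weight_family wk w" and pos: "\<forall>z. 0 < w z" and K: "compact K"
  obtains c where "0 < c"
    "\<forall>\<^sub>F k in sequentially. AE z in lebesgue. z \<in> K \<longrightarrow> c \<le> wk k z"
proof -
  have lim: "(\<lambda>k. Linf_norm lebesgue (\<lambda>z. wk k z - w z)) \<longlonglongrightarrow> 0" and cont: "continuous_on UNIV w"
    using wf by (auto simp: weight_family_def)
  obtain m where m: "0 < m" "\<And>z. z \<in> K \<Longrightarrow> m \<le> w z"
  proof (cases "K = {}")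
    case False
    then obtain z0 where "z0 \<in> K" "\<And>z. z \<in> K \<Longrightarrow> w z0 \<le> w z"
      using continuous_attains_inf[OF K] continuous_on_subset[OF cont] by blast
    then show thesis using that[of "w z0"] pos by blast
  qed (use that[of 1] in simp)
  have "\<forall>\<^sub>F k in sequentially. Linf_norm lebesgue (\<lambda>z. wk k z - w z) < ennreal (m / 2)"
    using m(1) by (intro order_tendstoD(2)[OF lim]) simp
  then have "\<forall>\<^sub>F k in sequentially. AE z in lebesgue. z \<in> K \<longrightarrow> m / 2 \<le> wk k z"
  proof eventually_elim
    case (elim k)
    have "AE z in lebesgue. ennreal \<bar>wk k z - w z\<bar> \<le> Linf_norm lebesgue (\<lambda>z. wk k z - w z)"
      unfolding Linf_norm_def by (rule esssup_AE)
    then show ?case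
    proof eventually_elim
      case (elim z)
      then have "ennreal \<bar>wk k z - w z\<bar> < ennreal (m / 2)"
        using \<open>Linf_norm lebesgue (\<lambda>z. wk k z - w z) < ennreal (m / 2)\<close> by (rule le_less_trans)
      then have "\<bar>wk k z - w z\<bar> < m / 2"
        by (simp add: ennreal_less_iff)
      then show ?case using m(2)[of z] by linarith
    qed
  qed
  then show thesis
    using that[of "m / 2"] m(1) by simp
qed

section \<open>Compactness\<close>

text \<open>The limit on the whole space is the limit on \<open>E\<close> extended by zero, since the functions \<open>u k\<close>
  vanish outside \<open>E\<close>; finitely many members of the sequence do not influence limits of
  subsequences.\<close>

lemma Lp_seq_compact_extend_by_zero:
  fixes u u' :: "nat \<Rightarrow> 'a::euclidean_space \<Rightarrow> real"
  assumes E[measurable]: "E \<in> sets lebesgue" and Lp: "\<And>k. u k \<in> Lp_space lebesgue p"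
    and supp: "\<And>k. AE x in lebesgue. x \<notin> E \<longrightarrow> u k x = 0"
    and ev: "\<forall>\<^sub>F k in sequentially. u' k = u k"
    and cpt: "Lp_seq_compact (lebesgue_on E) p u'"
  shows "Lp_seq_compact lebesgue p u"
  unfolding Lp_seq_compact_def
proof (intro conjI allI impI Lp)
  fix r :: "nat \<Rightarrow> nat" assume r: "strict_mono r"
  then obtain s v where s: "strict_mono s" and v: "v \<in> Lp_space (lebesgue_on E) p"
    and lim: "(\<lambda>k. Lp_norm (lebesgue_on E) p (\<lambda>x. u' (r (s k)) x - v x)) \<longlonglongrightarrow> 0"
    using cpt unfolding Lp_seq_compact_def by blast
  define V where "V x = indicator E x * v x" for x
  have V_powr: "\<bar>V x\<bar> powr p = indicator E x * \<bar>v x\<bar> powr p" for x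
    by (simp add: V_def indicator_def)
  have "V \<in> Lp_space lebesgue p"
    using v by (simp add: Lp_space_def V_powr borel_measurable_restrict_space_iff
        integrable_restrict_space flip: V_def)
  moreover have "(\<lambda>k. Lp_norm lebesgue p (\<lambda>x. u (r (s k)) x - V x)) \<longlonglongrightarrow> 0"
  proof (rule Lim_transform_eventually[OF lim])
    have "filterlim (\<lambda>k. r (s k)) sequentially sequentially"
      using filterlim_subseq[OF strict_mono_o[OF r s]] by (simp add: o_def)
    from eventually_compose_filterlim[OF ev this]
    show "\<forall>\<^sub>F k in sequentially. Lp_norm (lebesgue_on E) p (\<lambda>x. u' (r (s k)) x - v x)
        = Lp_norm lebesgue p (\<lambda>x. u (r (s k)) x - V x)"
    proof eventually_elim
      case (elim k)
      have "(LINT x|lebesgue_on E. \<bar>u (r (s k)) x - v x\<bar> powr p)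
          = (LINT x|lebesgue. indicator E x *\<^sub>R \<bar>u (r (s k)) x - v x\<bar> powr p)"
        by (rule integral_restrict_space) simp
      also have "\<dots> = (LINT x|lebesgue. \<bar>u (r (s k)) x - V x\<bar> powr p)"
      proof (rule integral_cong_AE)
        show "AE x in lebesgue. indicator E x *\<^sub>R \<bar>u (r (s k)) x - v x\<bar> powr p
            = \<bar>u (r (s k)) x - V x\<bar> powr p"
          using supp[of "r (s k)"] by eventually_elim (simp add: V_def indicator_def)
        have [measurable]: "u (r (s k)) \<in> borel_measurable lebesgue" "V \<in> borel_measurable lebesgue"
          using Lp \<open>V \<in> Lp_space lebesgue p\<close> by (auto simp: Lp_space_def)
        show "(\<lambda>x. \<bar>u (r (s k)) x - V x\<bar> powr p) \<in> borel_measurable lebesgue"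
          by measurable
        \<comment> \<open>The function \<open>v\<close> is measurable on \<open>E\<close> only, but under the indicator it agrees with \<open>V\<close>.\<close>
        have "(\<lambda>x. indicator E x *\<^sub>R \<bar>u (r (s k)) x - V x\<bar> powr p) \<in> borel_measurable lebesgue"
          by measurable
        also have "(\<lambda>x. indicator E x *\<^sub>R \<bar>u (r (s k)) x - V x\<bar> powr p)
            = (\<lambda>x. indicator E x *\<^sub>R \<bar>u (r (s k)) x - v x\<bar> powr p)"
          by (auto simp: V_def indicator_def)
        finally show "(\<lambda>x. indicator E x *\<^sub>R \<bar>u (r (s k)) x - v x\<bar> powr p) \<in> borel_measurable lebesgue" .
      qed
      finally show ?case by (simp add: Lp_norm_def elim)
    qed
  qed
  ultimately show "\<exists>s v. strict_mono s \<and> v \<in> Lp_space lebesgue p \<and>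
      (\<lambda>k. Lp_norm lebesgue p (\<lambda>x. u (r (s k)) x - v x)) \<longlonglongrightarrow> 0"
    using s by blast
qed

theorem theorem1p3:
  fixes p R :: real
    and \<rho> :: "nat \<Rightarrow> 'a::euclidean_space \<Rightarrow> real"
    and wk :: "nat \<Rightarrow> 'a \<times> 'a \<Rightarrow> real"
    and w :: "'a \<times> 'a \<Rightarrow> real"
    and u :: "nat \<Rightarrow> 'a \<Rightarrow> real"
  assumes "1 \<le> p"
    and "kernel_family p \<rho>"
    and "weight_family wk w"
    and "p_compact p \<rho>"
    and "\<forall>z. 0 < w z"
    and "0 < R"
    and "\<forall>k. u k \<in> Lp_supp p R"
    and "(SUP k. ennreal (Lp_norm lebesgue p (u k)) + energy p (\<rho> k) (wk k) (u k)) < \<infinity>"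
  shows "Lp_seq_compact lebesgue p u"
proof -
  have Lp: "u k \<in> Lp_space lebesgue p" for k
    using assms(7) by (simp add: Lp_supp_def)
  have supp: "AE x in lebesgue. x \<notin> cball 0 R \<longrightarrow> u k x = 0" for k
  proof -
    have "ess_support (u k) \<subseteq> cball 0 R"
      using assms(7) by (simp add: Lp_supp_def)
    then show ?thesis
      using AE_zero_off_ess_support[of "u k"] by (auto elim!: eventually_mono)
  qed
  define S where "S = (SUP k. ennreal (Lp_norm lebesgue p (u k)) + energy p (\<rho> k) (wk k) (u k))"
  have S_upper: "ennreal (Lp_norm lebesgue p (u k)) + energy p (\<rho> k) (wk k) (u k) \<le> S" for k
    unfolding S_def by (rule SUP_upper) simp
  obtain m where m: "S = ennreal m" "0 \<le> m"
    using assms(8) unfolding S_def[symmetric] by (cases S) auto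
  have norm_le: "Lp_norm lebesgue p (u k) \<le> m" and energy_le: "energy p (\<rho> k) (wk k) (u k) \<le> ennreal m" for k
  proof -
    have "ennreal (Lp_norm lebesgue p (u k)) \<le> ennreal m"
      using S_upper[of k] unfolding m(1) by (rule order_trans[rotated]) simp
    then show "Lp_norm lebesgue p (u k) \<le> m"
      using m(2) by simp
    show "energy p (\<rho> k) (wk k) (u k) \<le> ennreal m"
      using S_upper[of k] unfolding m(1) by (rule order_trans[rotated]) simp
  qed
  have "compact (cball (0::'a) (2 * R) \<times> cball (0::'a) (2 * R))"
    by (intro compact_Times compact_cball)
  then obtain c where c: "0 < c"
    "\<forall>\<^sub>F k in sequentially. AE z in lebesgue. z \<in> cball 0 (2 * R) \<times> cball 0 (2 * R) \<longrightarrow> c \<le> wk k z"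
    using weights_eventually_bounded_below[OF assms(3,5)] by blast
  obtain M where M: "0 \<le> M" "\<forall>\<^sub>F k in sequentially.
      (\<integral>\<^sup>+z. ennreal (\<rho> k z / (R powr p + norm z powr p)) \<partial>lebesgue) \<le> ennreal M"
    using kernel_tail_bounded[OF assms(2,6)] by blast
  define C where "C = ennreal (1 / c) * ennreal m + 4 * (ennreal (m powr p) * ennreal M)"
  have "\<forall>\<^sub>F k in sequentially. energy p (\<rho> k) (\<lambda>_. 1) (u k) \<le> C"
    using c(2) M(2)
  proof eventually_elim
    case (elim k)
    have "energy p (\<rho> k) (\<lambda>_. 1) (u k) \<le> ennreal (1 / c) * energy p (\<rho> k) (wk k) (u k)
      + 4 * ((\<integral>\<^sup>+x. ennreal (\<bar>u k x\<bar> powr p) \<partial>lebesgue)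
         * (\<integral>\<^sup>+z. ennreal (\<rho> k z / (R powr p + norm z powr p)) \<partial>lebesgue))"
      using assms(2) Lp[of k]
      by (intro energy_le_weighted_energy[OF assms(1,6) c(1) _ L1_loc_measurable supp _ elim(1)])
        (auto simp: kernel_family_def Lp_space_def)
    also have "\<dots> \<le> C"
      unfolding C_def nn_integral_powr_eq_Lp_norm[OF assms(1) Lp]
      using assms(1) norm_le[of k]
      by (intro add_mono mult_mono energy_le elim(2) ennreal_leI powr_mono2)
        (auto simp: Lp_norm_def)
    finally show ?case .
  qed
  then obtain K where K: "\<And>k. K \<le> k \<Longrightarrow> energy p (\<rho> k) (\<lambda>_. 1) (u k) \<le> C"
    unfolding eventually_sequentially by blast
  \<comment> \<open>Before the index \<open>K\<close> the weights may vanish, and the unweighted energy may be infinite.\<close>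
  define u' where "u' k = (if k < K then (\<lambda>_. 0) else u k)" for k
  have "energy_bounded p \<rho> u'"
    unfolding energy_bounded_def
  proof (intro conjI allI)
    show "u' k \<in> Lp_space lebesgue p" for k
      using Lp[of k] assms(1) by (simp add: u'_def Lp_space_def)
    have "ennreal (Lp_norm lebesgue p (u' k)) + energy p (\<rho> k) (\<lambda>_. 1) (u' k) \<le> ennreal m + C" for k
    proof (cases "k < K")
      case True
      then show ?thesis
        using assms(1) by (simp add: u'_def Lp_norm_def energy_def)
    next
      case False
      then show ?thesis
        using K[of k] norm_le[of k] by (auto simp: u'_def intro!: add_mono ennreal_leI)
    qed
    then have "(SUP k. ennreal (Lp_norm lebesgue p (u' k)) + energy p (\<rho> k) (\<lambda>_. 1) (u' k)) \<le> ennreal m + C"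
      by (rule SUP_least)
    also have "\<dots> < \<infinity>"
      by (simp add: C_def ennreal_mult_less_top)
    finally show "(SUP k. ennreal (Lp_norm lebesgue p (u' k)) + energy p (\<rho> k) (\<lambda>_. 1) (u' k)) < \<infinity>" .
  qed
  then have "Lp_seq_compact (lebesgue_on (cball 0 R)) p u'"
    using assms(4) compact_cball unfolding p_compact_def by blast
  moreover have "\<forall>\<^sub>F k in sequentially. u' k = u k"
    using eventually_ge_at_top[of K] by eventually_elim (simp add: u'_def)
  ultimately show ?thesis
    by (intro Lp_seq_compact_extend_by_zero[OF _ Lp supp]) auto
qed

end
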